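(* Let $f$ be a transcendental entire function and let $K(f)=\{z\in\mathbb{C} : (f^n(z))_{n\in\mathbb{N}} \text{ is bounded}\}$. Then $K(f)$ is either connected or has infinitely many components.
   Context: $f^n$ denotes the $n$th iterate of $f$. *)

theory Defs
  imports "HOL-Complex_Analysis.Complex_Analysis"
begin

definition transcendental_entire :: "(complex \<Rightarrow> complex) \<Rightarrow> bool" where
  "transcendental_entire f \<longleftrightarrow> f holomorphic_on UNIV \<and> \<not> (\<exists>p. \<forall>z. f z = poly p z)"

definition filled_julia :: "(complex \<Rightarrow> complex) \<Rightarrow> complex set" where
  "filled_julia f = {z. bounded (range (\<lambda>n. (f ^^ n) z))}"

end

theory Submission
  imports Defs
begin

text \<open>
  Suppose that K = K(f) is disconnected with finitely many components, so that each component is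
  relatively open in K. By Schottky's theorem, at a point p of K the iterates are either uniformly
  bounded near p, or omit at most one value on every neighbourhood of p.

  K is not open: otherwise every component is simply connected by the maximum principle, so by the
  Riemann mapping theorem and the Schwarz lemma it contains at most one periodic point (two of them
  would force an iterate to be the identity); but Fatou's argument with two local inverse branches
  shows that periodic points accumulate at points of the frontier of K.

  K has no isolated point p: otherwise K would be covered by the orbit of p and one further point,
  hence be finite, contradicting Picard's theorem.

  Now take p in K but not in its interior. By the pigeonhole principle some component C contains
  the images of the component of p under the iterates of order i + k d, k = 0, 1, .... Blowing up
  near p, all points of K but one lie in C, and the remaining point is isolated in K.
\<close>

section \<open>Value distribution: Picard's and Schottky's theorems\<close>

text \<open>Great Picard applied to f(1/z) at 0. The singularity there is essential: a limit of f at
  infinity would make f constant by Liouville, and a limit of 1/f would make f a polynomial.\<close>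

lemma transcendental_entire_Picard:
  assumes "transcendental_entire f"
  obtains a where "\<And>w. w \<noteq> a \<Longrightarrow> infinite {z. f z = w}"
proof -
  have holf: "f holomorphic_on UNIV" and nonpoly: "\<nexists>p. \<forall>z. f z = poly p z"
    using assms by (auto simp: transcendental_entire_def)
  have no_pole: False if "((inverse \<circ> f) \<longlongrightarrow> l) at_infinity" for l
  proof -
    obtain a n where "\<And>z. f z = (\<Sum>i\<le>n. a i * z ^ i)"
      using pole_at_infinity [OF holf \<open>((inverse \<circ> f) \<longlongrightarrow> l) at_infinity\<close>] by blast
    then have "f z = poly (\<Sum>i\<le>n. monom (a i) i) z" for z
      by (simp add: poly_sum poly_monom)
    then show False
      using nonpoly by blast
  qed
  have no_lim: False if "(f \<longlongrightarrow> l) at_infinity" for l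
  proof -
    have "f z = l" for z
      using Liouville_weak [OF holf that] by blast
    then have "f z = poly [:l:] z" for z
      by simp
    then show False
      using nonpoly by blast
  qed
  let ?g = "f \<circ> inverse"
  obtain a where a: "\<And>w. w \<noteq> a \<Longrightarrow> infinite {x. x \<in> UNIV - {0} \<and> ?g x = w}"
  proof (rule great_Picard_infinite [of UNIV 0 ?g])
    show "?g holomorphic_on UNIV - {0}"
      by (intro holomorphic_on_compose_gen [OF _ holf] holomorphic_intros) auto
    show "\<not> (?g \<longlongrightarrow> l) (at 0)" for l
      using no_lim [of l] lim_at_infinity_0 [of f l] by blast
    show "\<not> ((inverse \<circ> ?g) \<longlongrightarrow> l) (at 0)" for l
      using no_pole [of l] lim_at_infinity_0 [of "inverse \<circ> f" l] by (auto simp: comp_assoc)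
  qed auto
  show thesis
  proof
    fix w assume "w \<noteq> a"
    have "inverse ` {x. x \<in> UNIV - {0} \<and> ?g x = w} \<subseteq> {z. f z = w}"
      by auto
    then show "infinite {z. f z = w}"
      using a [OF \<open>w \<noteq> a\<close>] by (meson finite_imageD finite_subset inj_on_inverseI inverse_inverse_eq)
  qed
qed

text \<open>The point of this form is uniformity: M depends on R alone, so one bound serves all
  iterates, all centres and all radii.\<close>

lemma Schottky_ball:
  fixes R :: real
  obtains M where
    "\<And>h q r z. \<lbrakk>h holomorphic_on ball q r; \<And>w. w \<in> ball q r \<Longrightarrow> h w \<noteq> 0 \<and> h w \<noteq> 1;
       norm (h q) \<le> R; z \<in> ball q (r/2)\<rbrakk> \<Longrightarrow> norm (h z) \<le> M"
proof (rule that [of "exp (pi * exp (pi * (2 + 2 * R + 12 * (2/3) / (1 - 2/3))))"])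
  fix h :: "complex \<Rightarrow> complex" and q z :: complex and r :: real
  assume hol: "h holomorphic_on ball q r" and omit: "\<And>w. w \<in> ball q r \<Longrightarrow> h w \<noteq> 0 \<and> h w \<noteq> 1"
    and R: "norm (h q) \<le> R" and z: "z \<in> ball q (r/2)"
  have "r > 0"
    using z by (smt (verit) dist_not_less_zero half_gt_zero_iff mem_ball)
  \<comment> \<open>The closed disc of radius 3r/4 still lies in the open ball, and after rescaling
    it to the unit disc the radius r/2 becomes 2/3, the \<open>t\<close> of Schottky's
    theorem.\<close>
  define s where "s = 3 * r / 4"
  have "s > 0" "s < r"
    using \<open>r > 0\<close> by (auto simp: s_def)
  define g where "g \<zeta> = h (q + of_real s * \<zeta>)" for \<zeta>
  have sub: "q + of_real s * \<zeta> \<in> ball q r" if "\<zeta> \<in> cball 0 1" for \<zeta>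
  proof -
    have "s * norm \<zeta> \<le> s * 1"
      using that \<open>s > 0\<close> by (intro mult_left_mono) auto
    then have "s * norm \<zeta> < r"
      using \<open>s < r\<close> by simp
    then show ?thesis
      using \<open>s > 0\<close> by (simp add: dist_norm norm_mult)
  qed
  let ?\<zeta> = "(z - q) / of_real s"
  have "norm (g ?\<zeta>) \<le> exp (pi * exp (pi * (2 + 2 * R + 12 * (2/3) / (1 - 2/3))))"
  proof (rule Schottky [where f = g and z = ?\<zeta> and r = R and t = "2/3"])
    have "h \<circ> (\<lambda>\<zeta>. q + of_real s * \<zeta>) holomorphic_on cball 0 1"
      by (rule holomorphic_on_compose_gen [OF _ hol]) (use sub in \<open>auto intro!: holomorphic_intros\<close>)
    then show "g holomorphic_on cball 0 1"
      by (simp add: g_def [abs_def] o_def)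
    show "norm (g 0) \<le> R"
      using R by (simp add: g_def)
    show "\<not> (g \<zeta> = 0 \<or> g \<zeta> = 1)" if "\<zeta> \<in> cball 0 1" for \<zeta>
      using omit [OF sub [OF that]] by (auto simp: g_def)
    have "norm (z - q) \<le> r / 2"
      using z by (simp add: dist_norm norm_minus_commute)
    then have "norm (z - q) / s \<le> 2/3"
      using \<open>r > 0\<close> by (simp add: s_def divide_simps)
    then show "norm ?\<zeta> \<le> 2/3"
      using \<open>s > 0\<close> by (simp add: norm_divide)
  qed auto
  moreover have "g ?\<zeta> = h z"
    using \<open>s > 0\<close> by (simp add: g_def)
  ultimately show "norm (h z) \<le> exp (pi * exp (pi * (2 + 2 * R + 12 * (2/3) / (1 - 2/3))))"
    by simp
qed

section \<open>Iterates, invariance of K and the blow-up principle\<close>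

lemma funpow_holomorphic_on_UNIV:
  assumes "f holomorphic_on UNIV"
  shows "(f ^^ n) holomorphic_on UNIV"
proof (induction n)
  case 0
  then show ?case
    by (simp add: id_def)
next
  case (Suc n)
  then show ?case
    using holomorphic_on_compose_gen [OF Suc assms] by (simp add: o_def)
qed

text \<open>Dropping finitely many initial points does not affect boundedness of an orbit. This
  complete invariance lets points of K be pulled back as well as pushed forward.\<close>

lemma funpow_mem_filled_julia_iff: "(f ^^ n) z \<in> filled_julia f \<longleftrightarrow> z \<in> filled_julia f"
proof -
  let ?orb = "\<lambda>k. (f ^^ k) z"
  have "(f ^^ k) ((f ^^ n) z) = ?orb (k + n)" for k
    by (simp add: funpow_add)
  then have "range (\<lambda>k. (f ^^ k) ((f ^^ n) z)) = ?orb ` {n..}"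
    by (auto simp: image_iff) (metis le_add_diff_inverse2)
  moreover have "?orb ` UNIV = ?orb ` {..<n} \<union> ?orb ` {n..}"
    by (auto simp flip: image_Un intro!: arg_cong [where f = "image ?orb"])
  moreover have "bounded (?orb ` {..<n})"
    by (simp add: finite_imp_bounded)
  ultimately show ?thesis
    by (simp add: filled_julia_def)
qed

lemma mem_filled_julia_iff: "f z \<in> filled_julia f \<longleftrightarrow> z \<in> filled_julia f"
  using funpow_mem_filled_julia_iff [of 1] by simp

lemma periodic_mem_filled_julia:
  assumes "(f ^^ d) z = z" "d > 0"
  shows "z \<in> filled_julia f"
proof -
  have "(f ^^ n) z \<in> (\<lambda>k. (f ^^ k) z) ` {..<d}" for n
    using assms by (metis funpow_mod_eq image_eqI lessThan_iff mod_less_divisor)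
  then have "range (\<lambda>n. (f ^^ n) z) \<subseteq> (\<lambda>k. (f ^^ k) z) ` {..<d}"
    by blast
  then show ?thesis
    by (simp add: filled_julia_def) (meson bounded_subset finite_imp_bounded finite_imageI finite_lessThan)
qed

text \<open>A Montel-type alternative, mostly used in contrapositive form: if K contains no
  neighbourhood of p, the iterates omit at most one value near p. Normalising a, b to 0, 1 makes
  Schottky applicable, with a bound at the centre independent of k because the orbit of p is
  bounded. Only iterates of order i + k d are restricted, since the final argument controls no
  others; elsewhere i = 0 and d = 1.\<close>

lemma filled_julia_blow_up:
  assumes holf: "f holomorphic_on UNIV" and p: "p \<in> filled_julia f" and "d > 0" and "a \<noteq> b"
    and omit: "\<And>z k. z \<in> ball p r \<Longrightarrow> (f ^^ (i + k * d)) z \<noteq> a \<and> (f ^^ (i + k * d)) z \<noteq> b"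
  obtains M where "\<And>z n. z \<in> ball p (r/2) \<Longrightarrow> norm ((f ^^ n) z) \<le> M"
proof -
  obtain B where B: "\<And>n. norm ((f ^^ n) p) \<le> B"
    using p by (auto simp: filled_julia_def bounded_iff)
  define R where "R = (B + norm a) / norm (b - a)"
  obtain M0 where M0: "\<And>h q r z. \<lbrakk>h holomorphic_on ball q r; \<And>w. w \<in> ball q r \<Longrightarrow> h w \<noteq> 0 \<and> h w \<noteq> 1;
       norm (h q) \<le> R; z \<in> ball q (r/2)\<rbrakk> \<Longrightarrow> norm (h z) \<le> M0"
    using Schottky_ball [of R] by metis
  define M1 where "M1 = norm (b - a) * M0 + norm a"
  have M1: "norm ((f ^^ (i + k * d)) z) \<le> M1" if z: "z \<in> ball p (r/2)" for z k
  proof -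
    let ?F = "f ^^ (i + k * d)"
    define h where "h w = (?F w - a) / (b - a)" for w
    have "norm (h z) \<le> M0"
    proof (rule M0 [OF _ _ _ z])
      show "h holomorphic_on ball p r"
        unfolding h_def using \<open>a \<noteq> b\<close> funpow_holomorphic_on_UNIV [OF holf]
        by (intro holomorphic_intros holomorphic_on_subset [OF funpow_holomorphic_on_UNIV [OF holf]]) auto
      show "h w \<noteq> 0 \<and> h w \<noteq> 1" if "w \<in> ball p r" for w
        using omit [OF that, of k] \<open>a \<noteq> b\<close> by (auto simp: h_def)
      have "norm (?F p - a) \<le> B + norm a"
        using B norm_triangle_ineq4 [of "?F p" a] by (meson add_right_mono order_trans)
      then show "norm (h p) \<le> R"
        by (simp add: h_def R_def norm_divide divide_right_mono)
    qed
    moreover have "?F z = (b - a) * h z + a"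
      using \<open>a \<noteq> b\<close> by (simp add: h_def)
    then have "norm (?F z) \<le> norm (b - a) * norm (h z) + norm a"
      by (metis norm_mult norm_triangle_ineq)
    ultimately show ?thesis
      unfolding M1_def by (smt (verit) mult_left_mono norm_ge_zero)
  qed
  \<comment> \<open>The remaining iterates: those of order below i act on the disc about p, and any
    other is fewer than d applications of f after one already bounded by \<open>M1\<close>. So only
    finitely many compact images are needed.\<close>
  let ?S = "(\<Union>j<d. (f ^^ j) ` cball 0 M1) \<union> (\<Union>j<i. (f ^^ j) ` cball p (r/2))"
  have "bounded ((f ^^ j) ` cball c s)" for j c s
    by (meson compact_cball compact_continuous_image compact_imp_bounded funpow_holomorphic_on_UNIV holf
        holomorphic_on_imp_continuous_on holomorphic_on_subset subset_UNIV)
  then have "bounded ?S"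
    by (auto intro!: bounded_UN)
  then obtain M where M: "\<And>w. w \<in> ?S \<Longrightarrow> norm w \<le> M"
    by (meson bounded_iff)
  show thesis
  proof
    fix z n assume z: "z \<in> ball p (r/2)"
    show "norm ((f ^^ n) z) \<le> M"
    proof (cases "n < i")
      case True
      with z show ?thesis
        by (intro M) (auto intro!: bexI [of _ n])
    next
      case False
      define k j where "k = (n - i) div d" and "j = (n - i) mod d"
      have n: "n = j + (i + k * d)"
        using False by (simp add: k_def j_def)
      have "j < d"
        using \<open>d > 0\<close> by (simp add: j_def)
      moreover have "(f ^^ n) z = (f ^^ j) ((f ^^ (i + k * d)) z)"
        by (simp only: n funpow_add o_apply)
      ultimately have "(f ^^ n) z \<in> (f ^^ j) ` cball 0 M1"
        using M1 [OF z, of k] by auto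
      with \<open>j < d\<close> show ?thesis
        using M by blast
    qed
  qed
qed

section \<open>Components of an open K\<close>

lemma filled_julia_open_bounded_on_compact:
  assumes holf: "f holomorphic_on UNIV" and op: "open (filled_julia f)" and proper: "filled_julia f \<noteq> UNIV"
    and S: "compact S" "S \<subseteq> filled_julia f"
  obtains M where "\<And>z n. z \<in> S \<Longrightarrow> norm ((f ^^ n) z) \<le> M"
proof -
  obtain a where a: "a \<notin> filled_julia f"
    using proper by blast
  \<comment> \<open>A fixed point would lie in K, so a and f a are two distinct values that orbits
    in K never take.\<close>
  then have fa: "f a \<notin> filled_julia f" and "a \<noteq> f a"
    using periodic_mem_filled_julia [of 1 f a] by (auto simp: mem_filled_julia_iff)
  have "\<exists>r M. r > 0 \<and> (\<forall>z \<in> ball p r. \<forall>n. norm ((f ^^ n) z) \<le> M)" if p: "p \<in> filled_julia f" for p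
  proof -
    obtain r where r: "r > 0" "ball p r \<subseteq> filled_julia f"
      using op p openE by blast
    then have "(f ^^ n) z \<in> filled_julia f" if "z \<in> ball p r" for z n
      using that funpow_mem_filled_julia_iff by blast
    then obtain M where "\<And>z n. z \<in> ball p (r/2) \<Longrightarrow> norm ((f ^^ n) z) \<le> M"
      using filled_julia_blow_up [OF holf p zero_less_one \<open>a \<noteq> f a\<close>, of r 0] a fa by metis
    then show ?thesis
      using \<open>r > 0\<close> by (metis half_gt_zero)
  qed
  then obtain r M where r: "\<And>p. p \<in> filled_julia f \<Longrightarrow> r p > 0"
    and M: "\<And>p z n. \<lbrakk>p \<in> filled_julia f; z \<in> ball p (r p)\<rbrakk> \<Longrightarrow> norm ((f ^^ n) z) \<le> M p"
    by metis
  obtain T where T: "T \<subseteq> S" "finite T" "S \<subseteq> (\<Union>p\<in>T. ball p (r p))"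
  proof (rule compactE_image [OF S(1), of S "\<lambda>p. ball p (r p)"])
    show "S \<subseteq> (\<Union>p\<in>S. ball p (r p))"
      using r S by force
  qed auto
  show thesis
  proof
    fix z n assume "z \<in> S"
    then obtain p where p: "p \<in> T" "z \<in> ball p (r p)"
      using T by blast
    then have "norm ((f ^^ n) z) \<le> M p"
      using M S T by blast
    also have "\<dots> \<le> Max (M ` T)"
      using p T by simp
    finally show "norm ((f ^^ n) z) \<le> Max (M ` T)" .
  qed
qed

text \<open>The iterates are uniformly bounded on a closed curve in C, hence inside it by the
  maximum principle. The inside therefore belongs to K and, being attached to the curve, to C
  itself, so the curve winds around no point off C.\<close>

lemma simply_connected_component_filled_julia:
  assumes holf: "f holomorphic_on UNIV" and op: "open (filled_julia f)" and proper: "filled_julia f \<noteq> UNIV"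
    and C: "C \<in> components (filled_julia f)"
  shows "simply_connected C"
proof -
  have "open C" "connected C" "C \<subseteq> filled_julia f"
    using C op open_components in_components_connected in_components_subset by blast+
  have "winding_number g z = 0"
    if g: "path g" "path_image g \<subseteq> C" "pathfinish g = pathstart g" and "z \<notin> C" for g z
  proof (rule ccontr)
    let ?P = "path_image g"
    assume nz: "winding_number g z \<noteq> 0"
    have "z \<in> inside ?P"
      using winding_number_zero_in_outside [OF g(1,3)] nz \<open>z \<notin> C\<close> g(2) inside_Un_outside [of ?P] by blast
    have cP: "compact ?P" "connected ?P" "?P \<noteq> {}"
      using g by (auto simp: compact_path_image connected_path_image)
    obtain M where M: "\<And>z n. z \<in> ?P \<Longrightarrow> norm ((f ^^ n) z) \<le> M"
      using filled_julia_open_bounded_on_compact [OF holf op proper cP(1)] g \<open>C \<subseteq> filled_julia f\<close> by blast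
    have "norm ((f ^^ n) w) \<le> M" if "w \<in> inside ?P" for w n
    proof (rule maximum_modulus_frontier [OF _ _ _ _ that])
      note hol = funpow_holomorphic_on_UNIV [OF holf, of n]
      show "(f ^^ n) holomorphic_on interior (inside ?P)"
        using hol holomorphic_on_subset by blast
      show "continuous_on (closure (inside ?P)) (f ^^ n)"
        using hol holomorphic_on_subset holomorphic_on_imp_continuous_on by blast
      show "bounded (inside ?P)"
        using cP bounded_inside compact_imp_bounded by blast
      show "norm ((f ^^ n) v) \<le> M" if "v \<in> frontier (inside ?P)" for v
        using that M cP frontier_inside_subset [of ?P] compact_imp_closed by blast
    qed
    then have "inside ?P \<subseteq> filled_julia f"
      by (force simp: filled_julia_def bounded_iff)
    moreover have "connected (?P \<union> inside ?P)"
      using cP compact_imp_closed connected_with_inside by blast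
    ultimately have "?P \<union> inside ?P \<subseteq> C"
      using components_maximal [OF C] g cP \<open>C \<subseteq> filled_julia f\<close> by blast
    then show False
      using \<open>z \<in> inside ?P\<close> \<open>z \<notin> C\<close> by blast
  qed
  then show ?thesis
    using simply_connected_eq_winding_number_zero [OF \<open>open C\<close>] \<open>connected C\<close> by blast
qed

text \<open>A Riemann map followed by a disc automorphism sending the image of p to 0 conjugates F
  to a self-map of the disc that fixes 0 and another point \<xi>. Equality in the Schwarz lemma
  makes it a rotation, and fixing \<xi> makes the factor 1.\<close>

lemma two_fixed_points_imp_id:
  assumes "open U" "simply_connected U" "U \<noteq> UNIV"
    and holF: "F holomorphic_on U" and FU: "F ` U \<subseteq> U"
    and pq: "p \<in> U" "q \<in> U" "p \<noteq> q" "F p = p" "F q = q" and "z \<in> U"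
  shows "F z = z"
proof -
  obtain \<phi> \<psi> where hol: "\<phi> holomorphic_on U" "\<psi> holomorphic_on ball 0 1"
    and \<phi>: "\<And>z. z \<in> U \<Longrightarrow> \<phi> z \<in> ball 0 1 \<and> \<psi> (\<phi> z) = z"
    and \<psi>: "\<And>z. z \<in> ball 0 1 \<Longrightarrow> \<psi> z \<in> U \<and> \<phi> (\<psi> z) = z"
    using Riemann_mapping_theorem [of U] assms by blast
  obtain m k where "m (\<phi> p) = 0" and
    holm: "m holomorphic_on ball 0 1" "m ` ball 0 1 \<subseteq> ball 0 1" and
    holk: "k holomorphic_on ball 0 1" "k ` ball 0 1 \<subseteq> ball 0 1" and
    km: "\<And>z. z \<in> ball 0 1 \<Longrightarrow> k (m z) = z"
    using ball_biholomorphism_exists [of "\<phi> p"] \<phi> [OF pq(1)] by metis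
  define G where "G = m \<circ> \<phi> \<circ> F \<circ> \<psi> \<circ> k"
  have inverse_map: "\<psi> (k (m (\<phi> w))) = w" if "w \<in> U" for w
    using that \<phi> km by simp
  have G: "G (m (\<phi> w)) = m (\<phi> (F w))" if "w \<in> U" for w
    using inverse_map [OF that] by (simp add: G_def)
  have "\<psi> ` ball 0 1 \<subseteq> U" "\<phi> ` U \<subseteq> ball 0 1"
    using \<phi> \<psi> by blast+
  note maps = this
  have "G holomorphic_on ball 0 1"
    unfolding G_def
    by (intro holomorphic_on_compose_gen [where t = "ball 0 1"] holomorphic_on_compose_gen [where t = U] hol holm holk holF)
       (use maps FU holk holm in auto)
  moreover have "G 0 = 0"
    using G [OF pq(1)] pq(4) \<open>m (\<phi> p) = 0\<close> by simp
  moreover have "norm (G w) < 1" if "norm w < 1" for w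
  proof -
    have "k w \<in> ball 0 1"
      using that holk by (auto simp: image_subset_iff)
    then have "\<phi> (F (\<psi> (k w))) \<in> ball 0 1"
      using \<phi> \<psi> FU by blast
    then have "G w \<in> ball 0 1"
      using holm by (auto simp: G_def image_subset_iff)
    then show ?thesis
      by simp
  qed
  moreover
  let ?\<xi> = "m (\<phi> q)"
  have \<xi>: "norm ?\<xi> < 1" "?\<xi> \<noteq> 0" "G ?\<xi> = ?\<xi>"
  proof -
    show "norm ?\<xi> < 1"
      using holm \<phi> [OF pq(2)] by (auto simp: image_subset_iff)
    show "?\<xi> \<noteq> 0"
      using inverse_map pq \<open>m (\<phi> p) = 0\<close> by metis
    show "G ?\<xi> = ?\<xi>"
      using G pq by simp
  qed
  ultimately obtain \<alpha> where \<alpha>: "\<And>w. norm w < 1 \<Longrightarrow> G w = \<alpha> * w"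
    using Schwarz_Lemma(3) [of G ?\<xi>] by metis
  then have "\<alpha> = 1"
    using \<xi> by simp
  have "norm (m (\<phi> z)) < 1"
    using holm \<phi> [OF \<open>z \<in> U\<close>] by (auto simp: image_subset_iff)
  then have "m (\<phi> (F z)) = m (\<phi> z)"
    using \<alpha> \<open>\<alpha> = 1\<close> G [OF \<open>z \<in> U\<close>] by simp
  moreover have "F z \<in> U"
    using FU \<open>z \<in> U\<close> by blast
  ultimately show ?thesis
    using inverse_map \<open>z \<in> U\<close> by metis
qed

section \<open>Fatou's argument for periodic points\<close>

text \<open>The inverse function theorem; confining the branch to the e-ball about a is what later
  keeps two branches apart.\<close>

lemma holomorphic_local_section:
  assumes "f holomorphic_on UNIV" "deriv f a \<noteq> 0" "e > 0"
  obtains r \<phi> where "r > 0" "\<phi> holomorphic_on ball (f a) r"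
    "\<And>w. w \<in> ball (f a) r \<Longrightarrow> f (\<phi> w) = w" "\<phi> ` ball (f a) r \<subseteq> ball a e"
proof -
  obtain s where s: "s > 0" "inj_on f (ball a s)"
    using has_complex_derivative_locally_invertible [of f UNIV a] assms by auto
  define t where "t = min s e"
  have t: "t > 0" "inj_on f (ball a t)"
    using s \<open>e > 0\<close> by (auto simp: t_def intro: inj_on_subset)
  have hol: "f holomorphic_on ball a t"
    using assms holomorphic_on_subset by blast
  obtain g where g: "g holomorphic_on f ` ball a t" "\<And>z. z \<in> ball a t \<Longrightarrow> g (f z) = z"
    using holomorphic_has_inverse [OF hol open_ball t(2)] by metis
  have "open (f ` ball a t)"
    using open_mapping_thm3 [OF hol _ t(2)] by auto
  moreover have "f a \<in> f ` ball a t"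
    using t by auto
  ultimately obtain r where r: "r > 0" "ball (f a) r \<subseteq> f ` ball a t"
    using openE by blast
  show thesis
  proof
    show "g holomorphic_on ball (f a) r"
      using g r holomorphic_on_subset by blast
    show "f (g w) = w" if "w \<in> ball (f a) r" for w
      using that r g by fastforce
    have "g ` ball (f a) r \<subseteq> ball a t"
      using r g by fastforce
    then show "g ` ball (f a) r \<subseteq> ball a e"
      by (auto simp: t_def)
  qed fact
qed

text \<open>Without periodic points near z0, no iterate can meet either of two inverse branches of f
  there. Schottky, based at a nearby point of K, then transfers boundedness of that orbit to z0,
  which is not in K.\<close>

lemma periodic_points_accumulate:
  assumes holf: "f holomorphic_on UNIV" and z0: "z0 \<in> closure (filled_julia f)" "z0 \<notin> filled_julia f"
    and ab: "a \<noteq> b" "f a = z0" "f b = z0" "deriv f a \<noteq> 0" "deriv f b \<noteq> 0" and "e > 0"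
  obtains z n where "z \<in> ball z0 e" "n > 0" "(f ^^ n) z = z"
proof (rule ccontr)
  assume "\<not> thesis"
  then have no_per: "(f ^^ n) z \<noteq> z" if "z \<in> ball z0 e" "n > 0" for z n
    using \<open>\<And>z n. \<lbrakk>z \<in> ball z0 e; n > 0; (f ^^ n) z = z\<rbrakk> \<Longrightarrow> thesis\<close> that by blast
  \<comment> \<open>Discs of radius \<delta> about a and b stay at least 2 \<delta> apart, which
    bounds the denominator of \<open>h\<close> from below.\<close>
  define \<delta> where "\<delta> = dist a b / 4"
  have "\<delta> > 0"
    using ab by (simp add: \<delta>_def)
  obtain r1 \<phi>1 where r1: "r1 > 0" "\<phi>1 holomorphic_on ball z0 r1" "\<And>w. w \<in> ball z0 r1 \<Longrightarrow> f (\<phi>1 w) = w"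
    "\<phi>1 ` ball z0 r1 \<subseteq> ball a \<delta>"
    using holomorphic_local_section [OF holf ab(4) \<open>\<delta> > 0\<close>] ab by metis
  obtain r2 \<phi>2 where r2: "r2 > 0" "\<phi>2 holomorphic_on ball z0 r2" "\<And>w. w \<in> ball z0 r2 \<Longrightarrow> f (\<phi>2 w) = w"
    "\<phi>2 ` ball z0 r2 \<subseteq> ball b \<delta>"
    using holomorphic_local_section [OF holf ab(5) \<open>\<delta> > 0\<close>] ab by metis
  define s where "s = Min {e, r1, r2}"
  have s: "s > 0" "s \<le> e" "s \<le> r1" "s \<le> r2"
    using \<open>e > 0\<close> r1 r2 by (auto simp: s_def)
  have near: "dist a (\<phi>1 w) < \<delta>" "dist b (\<phi>2 w) < \<delta>" if "w \<in> ball z0 s" for w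
    using r1(4) r2(4) s that by (auto simp: image_subset_iff)
  have sep: "norm (\<phi>2 w - \<phi>1 w) \<ge> 2 * \<delta>" if "w \<in> ball z0 s" for w
  proof -
    have "dist a b \<le> dist a (\<phi>1 w) + dist (\<phi>1 w) (\<phi>2 w) + dist (\<phi>2 w) b"
      using dist_triangle [of a b "\<phi>2 w"] dist_triangle [of a "\<phi>2 w" "\<phi>1 w"] by linarith
    then show ?thesis
      using near [OF that] by (simp add: \<delta>_def dist_norm norm_minus_commute)
  qed
  have avoid: "(f ^^ n) w \<noteq> \<phi>1 w" "(f ^^ n) w \<noteq> \<phi>2 w" if "w \<in> ball z0 s" for w n
  proof -
    have "(f ^^ Suc n) w \<noteq> w"
      using that s by (intro no_per) auto
    then show "(f ^^ n) w \<noteq> \<phi>1 w" "(f ^^ n) w \<noteq> \<phi>2 w"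
      using r1(3) [of w] r2(3) [of w] that s by auto
  qed
  \<comment> \<open>With distance below s/8, the ball of radius s/2 about q lies in the s-ball about
    z0, and z0 lies in its concentric half.\<close>
  obtain q where q: "q \<in> filled_julia f" "dist q z0 < s / 8"
    using z0 s by (metis closure_approachable divide_pos_pos zero_less_numeral)
  have sub: "ball q (s/2) \<subseteq> ball z0 s"
  proof
    fix w assume "w \<in> ball q (s/2)"
    then show "w \<in> ball z0 s"
      using q s dist_triangle [of z0 w q] by (simp add: dist_commute)
  qed
  obtain B where B: "\<And>n. norm ((f ^^ n) q) \<le> B"
    using q by (auto simp: filled_julia_def bounded_iff)
  \<comment> \<open>A bound for \<open>h\<close> at q for all n at once: B bounds the orbit, norm a
    + \<delta> the first branch, and 2 \<delta> is the gap.\<close>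
  define R where "R = (B + norm a + \<delta>) / (2 * \<delta>)"
  obtain M where M: "\<And>h q r z. \<lbrakk>h holomorphic_on ball q r; \<And>w. w \<in> ball q r \<Longrightarrow> h w \<noteq> 0 \<and> h w \<noteq> 1;
       norm (h q) \<le> R; z \<in> ball q (r/2)\<rbrakk> \<Longrightarrow> norm (h z) \<le> M"
    using Schottky_ball [of R] by metis
  have "norm ((f ^^ n) z0) \<le> norm (\<phi>2 z0 - \<phi>1 z0) * M + norm (\<phi>1 z0)" for n
  proof -
    \<comment> \<open>A value 0 or 1 of h at w means that f maps the nth iterate of w back to w.\<close>
    define h where "h w = ((f ^^ n) w - \<phi>1 w) / (\<phi>2 w - \<phi>1 w)" for w
    have ne: "\<phi>2 w - \<phi>1 w \<noteq> 0" if "w \<in> ball z0 s" for w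
      using sep [OF that] \<open>\<delta> > 0\<close> by auto
    have "norm (h z0) \<le> M"
    proof (rule M [where h = h and q = q and r = "s/2" and z = z0])
      show "h holomorphic_on ball q (s/2)"
        unfolding h_def
        using r1 r2 s ne sub
        by (intro holomorphic_intros holomorphic_on_subset [OF funpow_holomorphic_on_UNIV [OF holf]]
              holomorphic_on_subset [OF r1(2)] holomorphic_on_subset [OF r2(2)]) auto
      show "h w \<noteq> 0 \<and> h w \<noteq> 1" if "w \<in> ball q (s/2)" for w
        using that sub avoid [of w n] ne [of w] by (auto simp: h_def)
      have "q \<in> ball z0 s"
        using q s by (simp add: dist_commute)
      have "norm (\<phi>1 q) \<le> norm a + \<delta>"
        using near(1) [OF \<open>q \<in> ball z0 s\<close>] norm_triangle_sub [of "\<phi>1 q" a]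
        by (simp add: dist_norm norm_minus_commute)
      then have "norm ((f ^^ n) q - \<phi>1 q) \<le> B + norm a + \<delta>"
        using B [of n] norm_triangle_ineq4 [of "(f ^^ n) q" "\<phi>1 q"] by linarith
      then show "norm (h q) \<le> R"
        using sep [OF \<open>q \<in> ball z0 s\<close>] \<open>\<delta> > 0\<close> order_trans [OF norm_ge_zero]
        unfolding h_def R_def norm_divide by (intro frac_le) auto
      show "z0 \<in> ball q (s/2/2)"
        using q s by simp
    qed
    moreover have "(f ^^ n) z0 = (\<phi>2 z0 - \<phi>1 z0) * h z0 + \<phi>1 z0"
      using ne [of z0] s by (simp add: h_def)
    then have "norm ((f ^^ n) z0) \<le> norm (\<phi>2 z0 - \<phi>1 z0) * norm (h z0) + norm (\<phi>1 z0)"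
      by (metis norm_mult norm_triangle_ineq)
    ultimately show ?thesis
      by (smt (verit) mult_left_mono norm_ge_zero)
  qed
  then have "z0 \<in> filled_julia f"
    by (auto simp: filled_julia_def bounded_iff)
  with z0 show False
    by blast
qed

section \<open>K is not open\<close>

text \<open>Removing a countable set leaves the plane connected, whereas removing the frontier
  splits it into S and the exterior of S. This leaves room to choose a frontier point outside any
  countable set.\<close>

lemma uncountable_frontier:
  fixes S :: "complex set"
  assumes "open S" "\<not> connected S"
  shows "uncountable (frontier S)"
proof
  assume "countable (frontier S)"
  then have conn: "connected (- frontier S)"
    using path_connected_open_diff_countable [of "UNIV :: complex set" "frontier S"]
    by (simp add: path_connected_imp_connected Compl_eq_Diff_UNIV)
  have eq: "- frontier S = S \<union> - closure S"
    using \<open>open S\<close> closure_subset by (auto simp: frontier_def interior_open)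
  have "S \<inter> - closure S \<inter> - frontier S = {}" "S \<inter> - frontier S = S" "- closure S \<inter> - frontier S = - closure S"
    using eq closure_subset by blast+
  then have "S = {} \<or> - closure S = {}"
    using connectedD [OF conn \<open>open S\<close>, of "- closure S"] eq by auto
  then show False
    using conn eq \<open>\<not> connected S\<close> by auto
qed

lemma transcendental_entire_not_inj:
  assumes "transcendental_entire f"
  shows "\<not> inj f"
proof
  assume "inj f"
  obtain a where a: "\<And>w. w \<noteq> a \<Longrightarrow> infinite {z. f z = w}"
    using transcendental_entire_Picard [OF assms] by blast
  have "infinite {z. f z = a + 1}"
    by (rule a) simp
  moreover have "finite {z. f z = a + 1}"
    using finite_vimageI [of "{a + 1}" f] \<open>inj f\<close> by (simp add: vimage_def)
  ultimately show False
    by blast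
qed

text \<open>Otherwise the derivative would vanish identically and f would be constant.\<close>

lemma countable_critical_points:
  assumes "transcendental_entire f"
  shows "countable {z. deriv f z = 0}"
proof (rule ccontr)
  assume unc: "uncountable {z. deriv f z = 0}"
  have holf: "f holomorphic_on UNIV"
    using assms by (simp add: transcendental_entire_def)
  then have "deriv f holomorphic_on UNIV"
    by (intro holomorphic_deriv) auto
  then have "deriv f = (\<lambda>z. 0)"
    using holomorphic_countable_equal_UNIV [of "deriv f" "\<lambda>z. 0"] unc by simp
  then have "(f has_field_derivative 0) (at z)" for z
    using holomorphic_derivI [OF holf, of z] by simp
  then obtain b where "\<And>z. f z = b"
    using has_field_derivative_zero_constant [of UNIV f] by auto
  then have "f z = poly [:b:] z" for z
    by simp
  then show False
    using assms by (metis transcendental_entire_def)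
qed

lemma filled_julia_not_open:
  assumes f: "transcendental_entire f" and fin: "finite (components (filled_julia f))"
    and disc: "\<not> connected (filled_julia f)"
  shows "\<not> open (filled_julia f)"
proof
  let ?K = "filled_julia f"
  let ?P = "{z. \<exists>n>0. (f ^^ n) z = z}"
  assume op: "open ?K"
  have holf: "f holomorphic_on UNIV"
    using f by (simp add: transcendental_entire_def)
  have proper: "?K \<noteq> UNIV"
    using disc by auto
  obtain c where c: "\<And>w. w \<noteq> c \<Longrightarrow> infinite {z. f z = w}"
    using transcendental_entire_Picard [OF f] by blast
  have "countable (insert c (f ` {z. deriv f z = 0}))"
    using countable_critical_points [OF f] by simp
  \<comment> \<open>Being different from the Picard exception \<open>c\<close>, z0 has at least two
    preimages; not being a critical value, it has a local inverse branch at each.\<close>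
  then obtain z0 where z0: "z0 \<in> frontier ?K" "z0 \<noteq> c" "z0 \<notin> f ` {z. deriv f z = 0}"
    using uncountable_frontier [OF op disc] by (metis countable_subset insertCI subsetI)
  have "z0 \<in> closure ?K" "z0 \<notin> ?K"
    using z0 op by (auto simp: frontier_def interior_open)
  obtain a where a: "f a = z0"
    using c [OF z0(2)] by (metis (mono_tags) empty_Collect_eq finite.emptyI)
  have "\<not> {z. f z = z0} \<subseteq> {a}"
    using c [OF z0(2)] finite_subset by blast
  then obtain b where b: "f b = z0" "a \<noteq> b"
    by blast
  have "deriv f w \<noteq> 0" if "f w = z0" for w
    using z0(3) that by blast
  then have der: "deriv f a \<noteq> 0" "deriv f b \<noteq> 0"
    using a b by auto
  have PK: "?P \<subseteq> ?K"
    using periodic_mem_filled_julia by blast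
  have "z0 islimpt ?P"
    unfolding islimpt_approachable
  proof (intro allI impI)
    fix e :: real assume "e > 0"
    obtain z n where "z \<in> ball z0 e" "n > 0" "(f ^^ n) z = z"
      using periodic_points_accumulate [OF holf \<open>z0 \<in> closure ?K\<close> \<open>z0 \<notin> ?K\<close> b(2) a b(1) der \<open>e > 0\<close>] by blast
    then have "z \<in> ?P" "dist z z0 < e"
      by (auto simp: dist_commute)
    moreover have "z \<noteq> z0"
      using \<open>z \<in> ?P\<close> \<open>z0 \<notin> ?K\<close> PK by blast
    ultimately show "\<exists>z\<in>?P. z \<noteq> z0 \<and> dist z z0 < e"
      by blast
  qed
  then have "infinite ?P"
    using islimpt_finite by blast
  moreover have "?P = (\<Union>C\<in>components ?K. ?P \<inter> C)"
    using PK Union_components [of ?K] by blast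
  \<comment> \<open>Pigeonhole: infinitely many periodic points in finitely many components.\<close>
  ultimately obtain C where C: "C \<in> components ?K" "infinite (?P \<inter> C)"
    using fin by (metis (no_types, lifting) finite_UN)
  then obtain p q where pq: "p \<in> ?P \<inter> C" "q \<in> ?P \<inter> C" "p \<noteq> q"
    by (metis (no_types, lifting) finite.emptyI finite_insert finite_subset insertCI subsetI)
  then obtain j k where jk: "j > 0" "k > 0" "(f ^^ j) p = p" "(f ^^ k) q = q"
    by blast
  \<comment> \<open>A common period, so that a single map f^N fixes both p and q and hence sends C
    into itself.\<close>
  define N where "N = j * k"
  have "N > 0"
    using jk by (simp add: N_def)
  have fix_mult: "(f ^^ (m * n)) z = z" if "(f ^^ n) z = z" for m n z
    using that by (induction m) (auto simp: funpow_add)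
  have N: "(f ^^ N) p = p" "(f ^^ N) q = q"
    using fix_mult jk by (metis N_def mult.commute)+
  have holN: "(f ^^ N) holomorphic_on S" for S
    using funpow_holomorphic_on_UNIV [OF holf] holomorphic_on_subset by blast
  have "open C" "connected C" "C \<subseteq> ?K"
    using C op open_components in_components_connected in_components_subset by blast+
  have "(f ^^ N) ` C \<subseteq> C"
  proof (rule components_maximal [OF C(1)])
    show "connected ((f ^^ N) ` C)"
      using \<open>connected C\<close> connected_continuous_image holN holomorphic_on_imp_continuous_on by blast
    show "(f ^^ N) ` C \<subseteq> ?K"
      using \<open>C \<subseteq> ?K\<close> funpow_mem_filled_julia_iff by blast
    show "C \<inter> (f ^^ N) ` C \<noteq> {}"
    proof -
      have "(f ^^ N) p \<in> (f ^^ N) ` C"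
        using pq by blast
      then show ?thesis
        using pq N by auto
    qed
  qed
  then have idC: "(f ^^ N) z = z" if "z \<in> C" for z
    using two_fixed_points_imp_id [OF \<open>open C\<close> simply_connected_component_filled_julia [OF holf op proper C(1)] _ holN]
      pq N that proper \<open>C \<subseteq> ?K\<close> by blast
  \<comment> \<open>The identity theorem extends f^N = id from C to the plane; f is then injective,
    contrary to Picard.\<close>
  have id: "(f ^^ N) z = z" for z
  proof -
    have "(f ^^ N) z - z = 0"
    proof (rule analytic_continuation [of "\<lambda>z. (f ^^ N) z - z" UNIV C p])
      show "(\<lambda>z. (f ^^ N) z - z) holomorphic_on UNIV"
        by (intro holomorphic_intros holN)
      show "p islimpt C"
        using pq \<open>open C\<close> interior_limit_point interior_open by blast
    qed (use idC in auto)
    then show ?thesis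
      by simp
  qed
  have "inj f"
  proof (rule injI)
    fix x y assume "f x = f y"
    then have "(f ^^ N) x = (f ^^ N) y"
      using \<open>N > 0\<close> by (metis funpow_swap1 gr0_conv_Suc funpow_simps_right(2) o_apply)
    then show "x = y"
      using id by simp
  qed
  then show False
    using transcendental_entire_not_inj [OF f] by blast
qed

section \<open>K has no isolated point\<close>

lemma filled_julia_no_isolated_point:
  assumes f: "transcendental_entire f" and fin: "finite (components (filled_julia f))"
    and disc: "\<not> connected (filled_julia f)" and p: "p \<in> filled_julia f" and "r > 0"
  shows "\<exists>z \<in> ball p r. z \<in> filled_julia f \<and> z \<noteq> p"
proof (rule ccontr)
  let ?K = "filled_julia f"
  assume "\<not> ?thesis"
  then have iso: "z = p" if "z \<in> ball p r" "z \<in> ?K" for z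
    using that by blast
  have holf: "f holomorphic_on UNIV"
    using f by (simp add: transcendental_entire_def)
  \<comment> \<open>If two values were omitted, the blow-up principle would put a whole disc about p
    into K.\<close>
  have hits: "\<exists>z \<in> ball p r. \<exists>n. (f ^^ n) z = a \<or> (f ^^ n) z = b" if "a \<noteq> b" for a b
  proof (rule ccontr)
    assume "\<not> ?thesis"
    then obtain M where M: "\<And>z n. z \<in> ball p (r/2) \<Longrightarrow> norm ((f ^^ n) z) \<le> M"
      using filled_julia_blow_up [OF holf p zero_less_one \<open>a \<noteq> b\<close>, of r 0] by metis
    then have "ball p (r/2) \<subseteq> ?K"
      by (force simp: filled_julia_def bounded_iff)
    moreover define z where "z = p + of_real (r/4)"
    moreover have "z \<in> ball p (r/2)" "z \<in> ball p r" "z \<noteq> p"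
      using \<open>r > 0\<close> by (simp_all add: z_def dist_norm)
    ultimately show False
      using iso by blast
  qed
  \<comment> \<open>A preimage of a point of K is in K, and p is the only point of K in the
    ball.\<close>
  have orbit: "v \<in> range (\<lambda>n. (f ^^ n) p)" if "v \<in> ?K" "z \<in> ball p r" "(f ^^ n) z = v" for v z n
    using that iso funpow_mem_filled_julia_iff by blast
  have "countable ?K"
  proof (cases "?K \<subseteq> range (\<lambda>n. (f ^^ n) p)")
    case True
    then show ?thesis
      by (meson countableI_type countable_image countable_subset)
  next
    case False
    then obtain a where a: "a \<in> ?K" "a \<notin> range (\<lambda>n. (f ^^ n) p)"
      by blast
    \<comment> \<open>Of the two values w and a one is attained near p; a cannot be, as it is off
      the orbit of p, so w is on that orbit.\<close>
    have "?K \<subseteq> insert a (range (\<lambda>n. (f ^^ n) p))"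
      using hits orbit a by (metis insert_iff subsetI)
    then show ?thesis
      by (meson countableI_type countable_image countable_insert countable_subset)
  qed
  \<comment> \<open>A countable connected set in the plane has at most one point.\<close>
  have "finite C" if "C \<in> components ?K" for C
    using that \<open>countable ?K\<close> connected_uncountable in_components_connected in_components_subset
    by (metis connected_finite_iff_sing countable_subset equals0I is_singletonI' is_singleton_def)
  then have "finite ?K"
    using fin Union_components [of ?K] by (metis finite_Union)
  obtain c where c: "\<And>w. w \<noteq> c \<Longrightarrow> infinite {z. f z = w}"
    using transcendental_entire_Picard [OF f] by blast
  obtain v where "v \<in> ?K" "v \<noteq> c"
    using disc by (metis connected_sing connected_empty is_singletonI' is_singleton_def)
  then have "{z. f z = v} \<subseteq> ?K"
    using mem_filled_julia_iff by blast
  then show False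
    using c [OF \<open>v \<noteq> c\<close>] \<open>finite ?K\<close> finite_subset by blast
qed

section \<open>Pigeonhole on the components and conclusion\<close>

theorem theorem1p1:
  fixes f :: "complex \<Rightarrow> complex"
  assumes "transcendental_entire f"
  shows "connected (filled_julia f) \<or> infinite (components (filled_julia f))"
proof (rule ccontr)
  let ?K = "filled_julia f"
  assume "\<not> ?thesis"
  then have disc: "\<not> connected ?K" and fin: "finite (components ?K)"
    by auto
  have holf: "f holomorphic_on UNIV"
    using assms by (simp add: transcendental_entire_def)
  \<comment> \<open>The other components are finitely many and closed in K, so their union is closed
    in K.\<close>
  have clopen: "\<exists>r>0. ball z r \<inter> ?K \<subseteq> C" if C: "C \<in> components ?K" "z \<in> C" for C z
  proof -
    have "closedin (top_of_set ?K) (\<Union>(components ?K - {C}))"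
      using fin closedin_component by (intro closedin_Union) auto
    moreover have "?K - \<Union>(components ?K - {C}) = C"
    proof -
      have "C' \<inter> C = {}" if "C' \<in> components ?K - {C}" for C'
        using that C(1) components_nonoverlap by blast
      moreover have "\<Union>(components ?K - {C}) \<union> C = ?K"
        using C(1) Union_components [of ?K] by blast
      ultimately show ?thesis
        by blast
    qed
    ultimately have "openin (top_of_set ?K) C"
      using openin_diff [OF openin_subtopology_self] by metis
    then show ?thesis
      using C by (auto simp: openin_contains_ball)
  qed
  obtain p where p: "p \<in> ?K" "p \<notin> interior ?K"
    using filled_julia_not_open [OF assms fin disc] interior_subset by (metis interior_eq subsetI subset_antisym)
  define A where "A = connected_component_set ?K p"
  have A: "A \<in> components ?K" "p \<in> A"
    using p by (auto simp: A_def componentsI)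
  obtain r where r: "r > 0" "ball p r \<inter> ?K \<subseteq> A"
    using clopen A by blast
  define S where "S n = connected_component_set ?K ((f ^^ n) p)" for n
  have S: "S n \<in> components ?K" "(f ^^ n) p \<in> S n" for n
    using p funpow_mem_filled_julia_iff by (auto simp: S_def componentsI)
  have image: "(f ^^ n) ` D \<subseteq> E" if "D \<in> components ?K" "E \<in> components ?K" "w \<in> D" "(f ^^ n) w \<in> E" for D E n w
  proof (rule components_maximal [OF that(2)])
    show "connected ((f ^^ n) ` D)"
      using that(1) funpow_holomorphic_on_UNIV [OF holf]
      by (meson connected_continuous_image holomorphic_on_imp_continuous_on holomorphic_on_subset in_components_connected subset_UNIV)
    show "(f ^^ n) ` D \<subseteq> ?K"
      using that(1) funpow_mem_filled_julia_iff in_components_subset by blast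
    show "E \<inter> (f ^^ n) ` D \<noteq> {}"
      using that by blast
  qed
  \<comment> \<open>Pigeonhole: the components met by the orbit of p repeat, so f^d maps
    \<open>S i\<close> into itself for some d > 0.\<close>
  have "\<not> inj S"
  proof
    assume "inj S"
    then have "finite (UNIV :: nat set)"
      using S fin by (metis finite_imageD finite_subset image_subsetI)
    then show False
      by simp
  qed
  then obtain i j where "i < j" "S i = S j"
    by (metis injI linorder_neqE_nat)
  define d where "d = j - i"
  have "d > 0"
    using \<open>i < j\<close> by (simp add: d_def)
  have "(f ^^ d) ((f ^^ i) p) \<in> S i"
  proof -
    have "(f ^^ d) ((f ^^ i) p) = (f ^^ j) p"
      using \<open>i < j\<close> by (metis add.commute add_diff_inverse_nat comp_apply d_def funpow_add less_imp_not_less)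
    then show ?thesis
      using S \<open>S i = S j\<close> by metis
  qed
  then have "(f ^^ d) ` S i \<subseteq> S i"
    using image S by blast
  then have iter: "(f ^^ (i + k * d)) ` A \<subseteq> S i" for k
  proof (induction k)
    case 0
    then show ?case
      using image [OF A(1) S(1) A(2) S(2)] by simp
  next
    case (Suc k)
    have "i + Suc k * d = d + (i + k * d)"
      by simp
    then have "(f ^^ (i + Suc k * d)) z = (f ^^ d) ((f ^^ (i + k * d)) z)" for z
      by (simp only: funpow_add o_apply)
    with Suc show ?case
      by (auto simp: image_subset_iff)
  qed
  have hits: "\<exists>z \<in> ball p r. \<exists>k. (f ^^ (i + k * d)) z = a \<or> (f ^^ (i + k * d)) z = b" if "a \<noteq> b" for a b
  proof (rule ccontr)
    assume "\<not> ?thesis"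
    then obtain M where M: "\<And>z n. z \<in> ball p (r/2) \<Longrightarrow> norm ((f ^^ n) z) \<le> M"
      using filled_julia_blow_up [OF holf p(1) \<open>d > 0\<close> \<open>a \<noteq> b\<close>, of r i] by metis
    then have "ball p (r/2) \<subseteq> ?K"
      by (force simp: filled_julia_def bounded_iff)
    then show False
      using p(2) \<open>r > 0\<close> by (meson centre_in_ball half_gt_zero interiorI open_ball)
  qed
  \<comment> \<open>A preimage z of v is in K, hence in A by the choice of r, and
    \<open>iter\<close> carries A into \<open>S i\<close>.\<close>
  have mem: "v \<in> S i" if "v \<in> ?K" "z \<in> ball p r" "(f ^^ (i + k * d)) z = v" for v z k
    using that r iter funpow_mem_filled_julia_iff by blast
  have "S i \<noteq> ?K"
    using disc S(1) in_components_connected by metis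
  then obtain v where v: "v \<in> ?K" "v \<notin> S i"
    using S(1) in_components_subset by blast
  \<comment> \<open>By \<open>mem\<close> the value v is not attained near p, so every other value
    is.\<close>
  have rest: "w \<in> S i" if "w \<in> ?K" "w \<noteq> v" for w
    using hits [OF that(2)] mem that v by metis
  define D where "D = connected_component_set ?K v"
  have D: "D \<in> components ?K" "v \<in> D"
    using v by (auto simp: D_def componentsI)
  obtain s where s: "s > 0" "ball v s \<inter> ?K \<subseteq> D"
    using clopen D by blast
  have "D \<inter> S i = {}"
    using D S(1) v components_nonoverlap by blast
  \<comment> \<open>Near v the set K lies in D, which misses \<open>S i\<close>, while K minus v
    lies in \<open>S i\<close>; so v is isolated.\<close>
  then have "z = v" if "z \<in> ball v s" "z \<in> ?K" for z
    using that s rest by blast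
  then show False
    using filled_julia_no_isolated_point [OF assms fin disc v(1) s(1)] by blast
qed

end
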